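(* Let $0<\delta<1$ and $a\in\mathbb{R}_{>0}$. Then $$\sum_{n=3}^\infty\delta^{a\log(\log(n))}=\infty.$$
   Context: $\log$ denotes the natural logarithm and $\mathbb{R}_{>0}$ the set of positive real numbers. *)

theory Defs
  imports Complex_Main
begin

end

theory Submission
  imports Defs "HOL-Real_Asymp.Real_Asymp"
begin

text \<open>The terms decrease in \<open>n\<close>, because \<open>\<delta> < 1\<close> and the exponent increases. Hence the sum up
to \<open>N\<close> is at least the number of terms times the last one, \<open>(N - 2) * \<delta> powr (a * ln (ln N))\<close>.
With \<open>c = - a * ln \<delta> > 0\<close> this bound is \<open>(N - 2) / (ln N) powr c\<close>, which tends to infinity
since every power of the logarithm grows more slowly than \<open>N\<close>.\<close>

theorem proposition4:
  fixes \<delta> a :: real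
  assumes "0 < \<delta>" and "\<delta> < 1" and "a > 0"
  shows "filterlim (\<lambda>N::nat. \<Sum>n=3..N. \<delta> powr (a * ln (ln (real n)))) at_top sequentially"
proof -
  define c where "c = - (a * ln \<delta>)"
  have "c > 0"
    using assms by (simp add: c_def mult_pos_neg)
  have term_eq: "\<delta> powr (a * ln (ln x)) = exp (- c * ln (ln x))" for x :: real
    using assms by (simp add: powr_def c_def algebra_simps)
  have "filterlim (\<lambda>N::nat. (real N - 2) * exp (- c * ln (ln (real N)))) at_top sequentially"
    using \<open>c > 0\<close> by real_asymp
  moreover have "(real N - 2) * exp (- c * ln (ln (real N)))
      \<le> (\<Sum>n=3..N. \<delta> powr (a * ln (ln (real n))))" if "N \<ge> 3" for N :: nat
  proof -
    have "exp (- c * ln (ln (real N))) \<le> \<delta> powr (a * ln (ln (real n)))" if "n \<in> {3..N}" for n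
    proof -
      have "0 < ln (real n)" "ln (real n) \<le> ln (real N)"
        using that by auto
      then have "ln (ln (real n)) \<le> ln (ln (real N))"
        by simp
      then show ?thesis
        using \<open>c > 0\<close> by (simp add: term_eq)
    qed
    then have "real (card {3..N}) * exp (- c * ln (ln (real N)))
        \<le> (\<Sum>n=3..N. \<delta> powr (a * ln (ln (real n))))"
      by (rule sum_bounded_below)
    moreover have "real (card {3..N}) = real N - 2"
      using \<open>N \<ge> 3\<close> by simp
    ultimately show ?thesis by simp
  qed
  then have "eventually (\<lambda>N. (real N - 2) * exp (- c * ln (ln (real N)))
      \<le> (\<Sum>n=3..N. \<delta> powr (a * ln (ln (real n))))) sequentially"
    using eventually_sequentially by blast
  ultimately show ?thesis
    by (rule filterlim_at_top_mono)
qed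

end
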